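(* Consider the system, costs and MPC feedback $\mu_{\mathrm{f}}$ with prediction horizon $N\in\mathbb{I}_{\ge1}$ and terminal cost $V_{\mathrm{f}}:X\to\mathbb{R}_{\ge0}$ described in the context, and let $\sigma:X\to\mathbb{R}_{\ge0}$, $\mathcal{A}\subseteq X$. Assume: (State measure) there are $\alpha_1,\alpha_2\in\mathcal{K}_\infty$ with $\alpha_1(\|x\|_{\mathcal A})\le\sigma(x)\le\alpha_2(\|x\|_{\mathcal A})$ for all $x\in X$; (Cost detectability) there are $W:X\to\mathbb{R}_{\ge0}$ and constants $\epsilon_{\mathrm{o}}>0$, $\underline{\gamma}_{\mathrm{o}},\overline{\gamma}_{\mathrm{o}}\ge0$ such that for all $(x,u)\in X\times\mathbb{U}$: $\underline{\gamma}_{\mathrm{o}}\sigma(x)\le W(x)\le\overline{\gamma}_{\mathrm{o}}\sigma(x)$ and $W(f(x,u))-W(x)\le-\epsilon_{\mathrm{o}}\sigma(x)+\ell(x,u)$; (Cost controllability) there are constants $\overline\gamma_{\mathrm{f}}\ge0$, $\gamma_{k,\mathrm{f}}\in[0,\overline\gamma_{\mathrm{f}}]$, $k\in\mathbb{I}_{\ge1}$, such that $V_{k,\mathrm{f}}(x)\le\gamma_{k,\mathrm{f}}\sigma(x)$ for all $x\in X$, $k\in\mathbb{I}_{\ge1}$; (Terminal cost) there are constants $\underline c_{\mathrm{f}},\overline c_{\mathrm{f}},\epsilon_{\mathrm{f}}>0$ such that for all $x\in X$: $\underline c_{\mathrm{f}}\sigma(x)\le V_{\mathrm{f}}(x)\le\overline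 c_{\mathrm{f}}\sigma(x)$, $\min_{u\in\mathbb{U}}\{V_{\mathrm{f}}(f(x,u))+\ell(x,u)\}\le(1+\epsilon_{\mathrm{f}})V_{\mathrm{f}}(x)$, and $\underline c_{\mathrm{f}}\le\frac{\gamma_{1,\mathrm{f}}}{1+\epsilon_{\mathrm{f}}}\le\overline c_{\mathrm{f}}$. Then for all $x\in X$ the function $Y_{N,\mathrm{f}}:=V_{N,\mathrm{f}}+W$ satisfies $$\epsilon_{\mathrm{o}}\sigma(x)\le Y_{N,\mathrm{f}}(x)\le(\gamma_{N,\mathrm{f}}+\overline\gamma_{\mathrm{o}})\sigma(x),\qquad Y_{N,\mathrm{f}}(f(x,\mu_{\mathrm{f}}(x)))-Y_{N,\mathrm{f}}(x)\le-\epsilon_{\mathrm{o}}\alpha_{N,\mathrm{f}}\sigma(x),$$ with $$\alpha_{N,\mathrm{f}}:=1-\frac{(\gamma_{N,\mathrm{f}}+\overline\gamma_{\mathrm{o}})\epsilon_{\mathrm{f}}\overline\gamma_{\mathrm{f}}}{\epsilon_{\mathrm{o}}\big((N-1)\epsilon_{\mathrm{o}}(1+\epsilon_{\mathrm{f}})+\overline\gamma_{\mathrm{f}}\big)}.$$ If additionally $$N>\underline N_{\mathrm{f}}:=1+\frac{\epsilon_{\mathrm{f}}}{1+\epsilon_{\mathrm{f}}}\frac{\overline\gamma_{\mathrm{f}}(\overline\gamma_{\mathrm{f}}+\overline\gamma_{\mathrm{o}})}{\epsilon_{\mathrm{o}}^2}-\frac{\overline\gamma_{\mathrm{f}}}{\epsilon_{\mathrm{o}}(1+\epsilon_{\mathrm{f}})},$$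 then $\alpha_{N,\mathrm{f}}\in(0,1]$, and furthermore for any $x_0\in X$ the set $\mathcal A$ is asymptotically stable for the closed loop $x_{\mu_{\mathrm{f}}}(\cdot)$ and $$\alpha_{N,\mathrm{f}}\big(\mathcal{J}^{\mu_{\mathrm{f}}}_\infty(x_0)+W(x_0)\big)\le\left[1+\frac{\overline c_{\mathrm{f}}}{\epsilon_{\mathrm{o}}}\left(1-\frac{\epsilon_{\mathrm{o}}}{\overline\gamma_{\mathrm{f}}+\overline\gamma_{\mathrm{o}}}\right)^N\right]Y_\infty(x_0),\qquad Y_\infty:=V_\infty+W.$$
   Context: $\mathbb{I}_{\ge a}$ denotes the integers $\ge a$. $\mathcal{K}_\infty$: continuous, strictly increasing, unbounded functions $\alpha:\mathbb{R}_{\ge0}\to\mathbb{R}_{\ge0}$ with $\alpha(0)=0$. $\|x\|_{\mathcal A}:=\inf_{s\in\mathcal A}\|x-s\|$. System: $x(k+1)=f(x(k),u(k))$ with $X=\mathbb{R}^n$, $\mathbb{U}\subseteq\mathbb{R}^m$, $f:X\times\mathbb{U}\to X$. For an input sequence $u$, $x_u(k,x)$ is the state after $k$ steps from $x_u(0,x)=x$. Stage cost $\ell:X\times\mathbb{U}\to\mathbb{R}_{\ge0}$. For $k\in\mathbb{I}_{\ge1}$: $\mathcal{J}_{k,\mathrm{f}}(x,u)=\sum_{j=0}^{k-1}\ell(x_u(j,x),u(j))+V_{\mathrm{f}}(x_u(k,x))$, $V_{k,\mathrm{f}}(x)=\inf_{u\in\mathbb{U}^k}\mathcal{J}_{k,\mathrm{f}}(x,u)$.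 Infinite-horizon optimal cost (without terminal cost): $V_\infty(x)=\inf_{u\in\mathbb{U}^\infty}\sum_{k=0}^\infty\ell(x_u(k,x),u(k))$. Minimizers of the optimal control problems are assumed to exist; $u^*_{N,\mathrm{f},x}\in\mathbb{U}^N$ denotes a minimizer of $\mathcal{J}_{N,\mathrm{f}}(x,\cdot)$ and $\mu_{\mathrm{f}}(x):=u^*_{N,\mathrm{f},x}(0)$. Closed loop: $x_{\mu_{\mathrm{f}}}(0)=x_0$, $u_{\mu_{\mathrm{f}}}(k)=\mu_{\mathrm{f}}(x_{\mu_{\mathrm{f}}}(k))$, $x_{\mu_{\mathrm{f}}}(k+1)=f(x_{\mu_{\mathrm{f}}}(k),u_{\mu_{\mathrm{f}}}(k))$; $\mathcal{J}^{\mu_{\mathrm{f}}}_\infty(x_0)=\sum_{k=0}^\infty\ell(x_{\mu_{\mathrm{f}}}(k),u_{\mu_{\mathrm{f}}}(k))$. Asymptotic stability of $\mathcal A$ is understood in the standard sense: Lyapunov stability of the set (for every $\varepsilon>0$ there is $\delta>0$ such that $\|x_0\|_{\mathcal A}\le\delta$ implies $\|x_{\mu_{\mathrm f}}(k)\|_{\mathcal A}\le\varepsilon$ for all $k$) together with $\|x_{\mu_{\mathrm f}}(k)\|_{\mathcal A}\to0$ for every $x_0\in X$. *)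

theory Defs
  imports "HOL-Analysis.Analysis"
begin

text \<open>
  The state space is \<open>real ^ 'n\<close>; the inputs are the elements of a set \<open>U\<close> of vectors in \<open>real ^ 'm\<close>.
  The dynamics \<open>f\<close> and the stage cost \<open>l\<close> are total functions, of which only the values at
  inputs in \<open>U\<close> matter.
\<close>

definition class_K_inf :: "(real \<Rightarrow> real) \<Rightarrow> bool" where
  "class_K_inf a \<longleftrightarrow>
     continuous_on {0..} a \<and> strict_mono_on {0..} a \<and> a 0 = 0 \<and> \<not> bdd_above (a ` {0..})"

primrec traj :: "('x \<Rightarrow> 'u \<Rightarrow> 'x) \<Rightarrow> (nat \<Rightarrow> 'u) \<Rightarrow> 'x \<Rightarrow> nat \<Rightarrow> 'x" where
  "traj f u x 0 = x"
| "traj f u x (Suc k) = f (traj f u x k) (u k)"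

primrec closed_loop :: "('x \<Rightarrow> 'u \<Rightarrow> 'x) \<Rightarrow> ('x \<Rightarrow> 'u) \<Rightarrow> 'x \<Rightarrow> nat \<Rightarrow> 'x" where
  "closed_loop f mu x 0 = x"
| "closed_loop f mu x (Suc k) = f (closed_loop f mu x k) (mu (closed_loop f mu x k))"

text \<open>The set of input sequences of length \<open>k\<close>, as extensional functions on \<open>{..<k}\<close>.\<close>

abbreviation inputs :: "nat \<Rightarrow> 'u set \<Rightarrow> (nat \<Rightarrow> 'u) set" where
  "inputs k U \<equiv> {..<k} \<rightarrow>\<^sub>E U"

definition cost ::
  "('x \<Rightarrow> 'u \<Rightarrow> 'x) \<Rightarrow> ('x \<Rightarrow> 'u \<Rightarrow> real) \<Rightarrow> ('x \<Rightarrow> real) \<Rightarrow> nat \<Rightarrow> 'x \<Rightarrow> (nat \<Rightarrow> 'u) \<Rightarrow> real" where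
  "cost f l Vf k x u = (\<Sum>j<k. l (traj f u x j) (u j)) + Vf (traj f u x k)"

definition opt_cost ::
  "('x \<Rightarrow> 'u \<Rightarrow> 'x) \<Rightarrow> 'u set \<Rightarrow> ('x \<Rightarrow> 'u \<Rightarrow> real) \<Rightarrow> ('x \<Rightarrow> real) \<Rightarrow> nat \<Rightarrow> 'x \<Rightarrow> real" where
  "opt_cost f U l Vf k x = (INF u\<in>inputs k U. cost f l Vf k x u)"

text \<open>Infinite-horizon costs are extended reals, so that divergent series have the value \<open>\<infinity>\<close>.\<close>

definition opt_cost_inf ::
  "('x \<Rightarrow> 'u \<Rightarrow> 'x) \<Rightarrow> 'u set \<Rightarrow> ('x \<Rightarrow> 'u \<Rightarrow> real) \<Rightarrow> 'x \<Rightarrow> ereal" where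
  "opt_cost_inf f U l x = (INF u\<in>UNIV \<rightarrow> U. \<Sum>k. ereal (l (traj f u x k) (u k)))"

definition closed_loop_cost ::
  "('x \<Rightarrow> 'u \<Rightarrow> 'x) \<Rightarrow> ('x \<Rightarrow> 'u \<Rightarrow> real) \<Rightarrow> ('x \<Rightarrow> 'u) \<Rightarrow> 'x \<Rightarrow> ereal" where
  "closed_loop_cost f l mu x =
     (\<Sum>k. ereal (l (closed_loop f mu x k) (mu (closed_loop f mu x k))))"

text \<open>
  \<open>ustar\<close> selects, for every initial state \<open>x\<close>, one minimizer of the horizon-\<open>N\<close> problem.
\<close>

definition optimal_selection ::
  "('x \<Rightarrow> 'u \<Rightarrow> 'x) \<Rightarrow> 'u set \<Rightarrow> ('x \<Rightarrow> 'u \<Rightarrow> real) \<Rightarrow> ('x \<Rightarrow> real) \<Rightarrow> nat \<Rightarrow>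
     ('x \<Rightarrow> nat \<Rightarrow> 'u) \<Rightarrow> bool" where
  "optimal_selection f U l Vf N ustar \<longleftrightarrow>
     (\<forall>x. is_arg_min (cost f l Vf N x) (\<lambda>u. u \<in> inputs N U) (ustar x))"

text \<open>\<open>phi x k\<close> is the state at time \<open>k\<close> of the solution starting at \<open>x\<close>.\<close>

definition asymptotically_stable ::
  "'x::metric_space set \<Rightarrow> ('x \<Rightarrow> nat \<Rightarrow> 'x) \<Rightarrow> bool" where
  "asymptotically_stable A phi \<longleftrightarrow>
     (\<forall>\<epsilon>>0. \<exists>\<delta>>0. \<forall>x. infdist x A \<le> \<delta> \<longrightarrow> (\<forall>k. infdist (phi x k) A \<le> \<epsilon>)) \<and>
     (\<forall>x. (\<lambda>k. infdist (phi x k) A) \<longlonglongrightarrow> 0)"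

end

theory Submission
  imports Defs
begin

text \<open>
  By Bellman's principle, a step of the closed loop decreases \<open>V\<^sub>N\<close> by the stage cost, up to an
  error \<open>E\<close> caused by the horizon that recedes by one step. If \<open>x\<^sub>0, \<dots>, x\<^sub>N\<close> is an optimal trajectory
  from \<open>x\<close>, then re-optimizing from \<open>x\<^sub>k\<close> on, with the horizon longer by one, bounds \<open>E\<close> by the
  difference \<open>V\<^sub>N\<^sub>-\<^sub>k\<^sub>+\<^sub>1 - V\<^sub>N\<^sub>-\<^sub>k\<close> at \<open>x\<^sub>k\<close>. Such a difference is at most
  \<open>\<epsilon>f / (1 + \<epsilon>f) * \<gamma>f_up * \<sigma> x\<^sub>k\<close>, because one more step inflates the optimal cost by at most the
  factor \<open>1 + \<epsilon>f\<close> (\<open>V_Suc_increment\<close>); at the end of the trajectory it is at most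
  \<open>\<epsilon>f * Vf x\<^sub>N\<close>. Detectability bounds \<open>\<epsilon>o * (\<Sum>k<N. \<sigma> x\<^sub>k) + Vf x\<^sub>N\<close> by \<open>Y\<^sub>N x\<close>, hence by a multiple
  of \<open>\<sigma> x\<close>. Adding the \<open>N\<close> bounds on \<open>E\<close> gives \<open>E \<le> (1 - \<alpha>\<^sub>N) * \<epsilon>o * \<sigma> x\<close>
  (\<open>first_step_suboptimality\<close>), with the loss \<open>1 - \<alpha>\<^sub>N\<close> of order \<open>1 / N\<close>.

  So \<open>Y\<^sub>N = V\<^sub>N + W\<close> is a Lyapunov function as soon as \<open>\<alpha>\<^sub>N > 0\<close>, and \<open>\<sigma>\<close> is summable along the closed
  loop; the comparison functions carry this over to the distance from \<open>A\<close>. Since the stage cost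
  plus the decrease of \<open>W\<close> dominates \<open>\<epsilon>o * \<sigma>\<close>, the same estimate bounds
  \<open>\<alpha>\<^sub>N * (J\<^sub>\<infinity> + W)\<close> by \<open>Y\<^sub>N\<close>, where \<open>J\<^sub>\<infinity>\<close> is the cost of the closed loop.

  It remains to compare \<open>Y\<^sub>N\<close> with \<open>Y\<^sub>\<infinity>\<close> (\<open>Y_le_Y_inf\<close>). The performance bound, applied to
  horizons \<open>M \<rightarrow> \<infinity>\<close> with \<open>\<alpha>\<^sub>M \<rightarrow> 1\<close>, yields \<open>Y\<^sub>\<infinity> \<le> (\<gamma>f_up + \<gamma>o_up) * \<sigma>\<close>. Hence \<open>Y\<^sub>\<infinity>\<close> contracts by the
  factor \<open>1 - \<epsilon>o / (\<gamma>f_up + \<gamma>o_up)\<close> in each step of an optimal infinite-horizon trajectory, and after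
  \<open>N\<close> steps the terminal cost is at most \<open>cf_up / \<epsilon>o\<close> times the \<open>N\<close>-th power of this factor times
  \<open>Y\<^sub>\<infinity> x\<close>. Infinite-horizon minimizers need not exist, so the argument is run with
  near-minimizers, and their tolerance tends to \<open>0\<close>.
\<close>

section \<open>Finite-horizon optimal costs\<close>

lemma traj_Suc_shift:
  "traj f u x (Suc k) = traj f (\<lambda>j. u (Suc j)) (f x (u 0)) k"
  by (induction k) auto

lemma traj_cong:
  "(\<And>j. j < k \<Longrightarrow> u j = v j) \<Longrightarrow> traj f u x k = traj f v x k"
  by (induction k) auto

lemma traj_add:
  "traj f u x (k + m) = traj f (\<lambda>j. u (k + j)) (traj f u x k) m"
  by (induction m) auto

lemma closed_loop_eq_traj:
  "closed_loop f mu x k = traj f (\<lambda>j. mu (closed_loop f mu x j)) x k"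
  by (induction k) auto

lemma cost_cong:
  assumes "\<And>j. j < k \<Longrightarrow> u j = v j"
  shows "cost f l Vf k x u = cost f l Vf k x v"
proof -
  have "traj f u x j = traj f v x j" if "j \<le> k" for j
    using that assms by (intro traj_cong) auto
  thus ?thesis
    unfolding cost_def using assms by (intro arg_cong2[of _ _ _ _ "(+)"] sum.cong) auto
qed

lemma cost_split:
  "cost f l Vf (k + m) x u =
     (\<Sum>j<k. l (traj f u x j) (u j)) + cost f l Vf m (traj f u x k) (\<lambda>j. u (k + j))"
proof -
  have "(\<Sum>j<k + m. h j) = (\<Sum>j<k. h j) + (\<Sum>j<m. h (k + j))" for h :: "nat \<Rightarrow> real"
    by (induction m) auto
  thus ?thesis
    by (simp add: cost_def traj_add)
qed

lemma opt_cost_eq_minimum: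
  assumes "is_arg_min (cost f l Vf k x) (\<lambda>u. u \<in> inputs k U) u"
  shows "opt_cost f U l Vf k x = cost f l Vf k x u"
  unfolding opt_cost_def
  using assms by (intro cInf_eq_minimum) (auto simp: is_arg_min_linorder)

lemma opt_cost_0: "opt_cost f U l Vf 0 x = Vf x"
  by (simp add: opt_cost_def cost_def)


section \<open>Asymptotic stability from a state measure\<close>

text \<open>
  The two comparison functions transfer statements about \<open>\<sigma>\<close> to the distance from \<open>A\<close>:
  \<open>\<alpha>2\<close> is small near \<open>0\<close> by continuity, and \<open>\<alpha>1\<close>, being strictly increasing, can only be small
  when its argument is.
\<close>

lemma asymptotically_stable_if_state_measure:
  fixes \<sigma> :: "'x::metric_space \<Rightarrow> real"
  assumes K: "class_K_inf \<alpha>1" "class_K_inf \<alpha>2"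
    and bounds: "\<And>x. \<alpha>1 (infdist x A) \<le> \<sigma> x" "\<And>x. \<sigma> x \<le> \<alpha>2 (infdist x A)"
    and "C > 0" and stable: "\<And>x k. \<sigma> (phi x k) \<le> C * \<sigma> x"
    and attractive: "\<And>x. (\<lambda>k. \<sigma> (phi x k)) \<longlonglongrightarrow> 0"
  shows "asymptotically_stable A phi"
proof -
  have mono1: "\<alpha>1 r < \<alpha>1 s" if "0 \<le> r" "r < s" for r s
    using K(1) that by (auto simp: class_K_inf_def strict_mono_on_def)
  have mono2: "\<alpha>2 r \<le> \<alpha>2 s" if "0 \<le> r" "r \<le> s" for r s
    using K(2) that by (cases "r = s") (auto simp: class_K_inf_def strict_mono_on_def less_le)
  have pos1: "0 < \<alpha>1 e" if "e > 0" for e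
    using mono1[of 0 e] that K(1) by (simp add: class_K_inf_def)
  have "\<exists>d>0. \<forall>x. infdist x A \<le> d \<longrightarrow> (\<forall>k. infdist (phi x k) A \<le> e)" if "e > 0" for e
  proof -
    have "\<alpha>1 e / C > 0" using pos1[OF that] \<open>C > 0\<close> by simp
    moreover have "continuous_on {0..} \<alpha>2" "\<alpha>2 0 = 0"
      using K(2) by (auto simp: class_K_inf_def)
    ultimately obtain d where d: "d > 0"
      "\<And>s. s \<ge> 0 \<Longrightarrow> dist s 0 < d \<Longrightarrow> dist (\<alpha>2 s) 0 < \<alpha>1 e / C"
      unfolding continuous_on_iff by (metis atLeast_iff order_refl)
    have "infdist (phi x k) A \<le> e" if x: "infdist x A \<le> d / 2" for x k
    proof (rule ccontr)
      assume "\<not> infdist (phi x k) A \<le> e"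
      hence "\<alpha>1 e < \<alpha>1 (infdist (phi x k) A)"
        using mono1[of e] \<open>e > 0\<close> by simp
      also have "\<dots> \<le> C * \<sigma> x" using bounds(1) stable order_trans by blast
      also have "\<dots> \<le> C * \<alpha>2 (d / 2)"
        using bounds(2)[of x] mono2[OF infdist_nonneg x] \<open>C > 0\<close> by simp
      also have "\<dots> < \<alpha>1 e"
      proof -
        have "\<alpha>2 (d / 2) < \<alpha>1 e / C"
          using d(2)[of "d / 2"] d(1) by (simp add: dist_real_def)
        thus ?thesis using \<open>C > 0\<close> by (simp add: pos_less_divide_eq mult.commute)
      qed
      finally show False .
    qed
    thus ?thesis using d(1) by (intro exI[of _ "d / 2"]) auto
  qed
  moreover have "(\<lambda>k. infdist (phi x k) A) \<longlonglongrightarrow> 0" for x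
  proof (rule LIMSEQ_I)
    fix e :: real assume "e > 0"
    have "eventually (\<lambda>k. \<sigma> (phi x k) < \<alpha>1 e) sequentially"
      using order_tendstoD(2)[OF attractive pos1[OF \<open>e > 0\<close>]] .
    then obtain K where K: "\<And>k. k \<ge> K \<Longrightarrow> \<sigma> (phi x k) < \<alpha>1 e"
      by (auto simp: eventually_sequentially)
    have "norm (infdist (phi x k) A - 0) < e" if "k \<ge> K" for k
    proof (rule ccontr)
      assume "\<not> norm (infdist (phi x k) A - 0) < e"
      hence "e \<le> infdist (phi x k) A" by (simp add: infdist_nonneg)
      hence "\<alpha>1 e \<le> \<alpha>1 (infdist (phi x k) A)"
        using mono1[of e] \<open>e > 0\<close> by (cases "e = infdist (phi x k) A") (auto simp: less_le)
      thus False using bounds(1)[of "phi x k"] K[OF that] by simp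
    qed
    thus "\<exists>K. \<forall>k\<ge>K. norm (infdist (phi x k) A - 0) < e" by blast
  qed
  ultimately show ?thesis unfolding asymptotically_stable_def by blast
qed


section \<open>Optimal control with a relaxed terminal cost\<close>

text \<open>
  Here the state space carries no structure: the state enters the estimates only through the
  measure \<open>\<sigma>\<close>.
\<close>

locale mpc =
  fixes f :: "'x \<Rightarrow> 'u \<Rightarrow> 'x" and U :: "'u set" and l :: "'x \<Rightarrow> 'u \<Rightarrow> real"
    and Vf \<sigma> W :: "'x \<Rightarrow> real" and \<gamma> :: "nat \<Rightarrow> real" and \<epsilon>o \<gamma>o \<gamma>_up \<epsilon>f :: real
  assumes l_nonneg: "\<And>x u. u \<in> U \<Longrightarrow> 0 \<le> l x u"
    and Vf_nonneg: "\<And>x. 0 \<le> Vf x"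
    and \<sigma>_nonneg: "\<And>x. 0 \<le> \<sigma> x"
    and W_nonneg: "\<And>x. 0 \<le> W x"
    and minimizers_exist:
      "\<And>k x. k \<ge> 1 \<Longrightarrow> \<exists>u. is_arg_min (cost f l Vf k x) (\<lambda>u. u \<in> inputs k U) u"
    and \<epsilon>o_pos: "\<epsilon>o > 0" and \<gamma>o_nonneg: "\<gamma>o \<ge> 0" and \<epsilon>f_pos: "\<epsilon>f > 0" and \<gamma>_up_pos: "\<gamma>_up > 0"
    and W_upper: "\<And>x. W x \<le> \<gamma>o * \<sigma> x"
    and W_decrease: "\<And>x u. u \<in> U \<Longrightarrow> W (f x u) - W x \<le> - \<epsilon>o * \<sigma> x + l x u"
    and \<gamma>_nonneg: "\<And>k. k \<ge> 1 \<Longrightarrow> 0 \<le> \<gamma> k"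
    and \<gamma>_le: "\<And>k. k \<ge> 1 \<Longrightarrow> \<gamma> k \<le> \<gamma>_up"
    and V_bound: "\<And>k x. k \<ge> 1 \<Longrightarrow> opt_cost f U l Vf k x \<le> \<gamma> k * \<sigma> x"
    and Vf_relaxed_CLF: "\<And>x. \<exists>u\<in>U. Vf (f x u) + l x u \<le> (1 + \<epsilon>f) * Vf x"
begin

abbreviation "V \<equiv> opt_cost f U l Vf"
abbreviation "Y N x \<equiv> V N x + W x"

text \<open>
  \<open>1 - \<alpha> N\<close> is the fraction of the guaranteed decrease \<open>\<epsilon>o * \<sigma>\<close> that can be lost because the
  feedback optimizes over a finite horizon with a terminal cost that may grow by the factor
  \<open>1 + \<epsilon>f\<close>.
\<close>

definition \<alpha> :: "nat \<Rightarrow> real" where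
  "\<alpha> N = 1 - (\<gamma> N + \<gamma>o) * \<epsilon>f * \<gamma>_up / (\<epsilon>o * ((real N - 1) * \<epsilon>o * (1 + \<epsilon>f) + \<gamma>_up))"

lemma V_minimizer:
  obtains u where "u \<in> inputs k U" "V k x = cost f l Vf k x u"
proof (cases "k = 0")
  case True
  thus ?thesis using that[of "\<lambda>_. undefined"] by (simp add: opt_cost_0 cost_def)
next
  case False
  then obtain u where "is_arg_min (cost f l Vf k x) (\<lambda>u. u \<in> inputs k U) u"
    using minimizers_exist[of k x] by auto
  thus ?thesis using that opt_cost_eq_minimum by (metis is_arg_min_linorder)
qed

lemma V_le_cost:
  assumes "\<And>j. j < k \<Longrightarrow> u j \<in> U"
  shows "V k x \<le> cost f l Vf k x u"
proof -
  let ?u = "restrict u {..<k}"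
  have "?u \<in> inputs k U" using assms by auto
  have "V k x \<le> cost f l Vf k x ?u"
  proof (cases "k = 0")
    case True thus ?thesis by (simp add: opt_cost_0 cost_def)
  next
    case False
    then obtain v where "is_arg_min (cost f l Vf k x) (\<lambda>u. u \<in> inputs k U) v"
      using minimizers_exist[of k x] by auto
    thus ?thesis using opt_cost_eq_minimum \<open>?u \<in> _\<close> by (metis is_arg_min_linorder)
  qed
  also have "\<dots> = cost f l Vf k x u" by (intro cost_cong) auto
  finally show ?thesis .
qed

lemma V_nonneg: "0 \<le> V k x"
proof -
  obtain u where "u \<in> inputs k U" "V k x = cost f l Vf k x u" by (rule V_minimizer)
  thus ?thesis unfolding cost_def
    by (auto intro!: add_nonneg_nonneg sum_nonneg l_nonneg Vf_nonneg)
qed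

lemma V_upper: "V (Suc k) x \<le> \<gamma>_up * \<sigma> x"
  using V_bound[of "Suc k" x] mult_right_mono[OF \<gamma>_le[of "Suc k"] \<sigma>_nonneg[of x]] by simp

lemma V_Suc_le:
  assumes "u \<in> U"
  shows "V (Suc k) x \<le> l x u + V k (f x u)"
proof -
  obtain v where v: "v \<in> inputs k U" "V k (f x u) = cost f l Vf k (f x u) v"
    by (rule V_minimizer)
  have "V (Suc k) x \<le> cost f l Vf (Suc k) x (case_nat u v)"
    using assms v(1) by (intro V_le_cost) (auto split: nat.split)
  also have "\<dots> = l x u + cost f l Vf k (f x u) v"
    using cost_split[of f l Vf 1 k x "case_nat u v"] by simp
  finally show ?thesis using v(2) by simp
qed

lemma V_le_split:
  assumes "\<And>j. j < k \<Longrightarrow> u j \<in> U"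
  shows "V (k + m) x \<le> (\<Sum>j<k. l (traj f u x j) (u j)) + V m (traj f u x k)"
  using assms
proof (induction k arbitrary: m)
  case (Suc k)
  show ?case
    using Suc.IH[of "Suc m"] V_Suc_le[OF Suc.prems[of k], of m "traj f u x k"] Suc.prems
    by simp
qed simp

text \<open>Tails of minimizers are minimizers (Bellman's principle).\<close>

lemma V_eq_split:
  assumes "u \<in> inputs (k + m) U" "V (k + m) x = cost f l Vf (k + m) x u"
  shows "V (k + m) x = (\<Sum>j<k. l (traj f u x j) (u j)) + V m (traj f u x k)"
proof (rule antisym)
  have inU: "u j \<in> U" if "j < k + m" for j using PiE_mem[OF assms(1)] that by simp
  show "V (k + m) x \<le> (\<Sum>j<k. l (traj f u x j) (u j)) + V m (traj f u x k)"
    by (rule V_le_split) (simp add: inU)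
  have "V m (traj f u x k) \<le> cost f l Vf m (traj f u x k) (\<lambda>j. u (k + j))"
    by (rule V_le_cost) (simp add: inU)
  thus "(\<Sum>j<k. l (traj f u x j) (u j)) + V m (traj f u x k) \<le> V (k + m) x"
    unfolding assms(2) cost_split by simp
qed

text \<open>
  Appending one step of the relaxed control Lyapunov function inflates the terminal cost at the end
  of a minimizer by at most the factor \<open>1 + \<epsilon>f\<close>.
\<close>

lemma V_Suc_le_terminal:
  assumes "u \<in> inputs k U" "V k x = cost f l Vf k x u"
  shows "V (Suc k) x \<le> V k x + \<epsilon>f * Vf (traj f u x k)"
proof -
  let ?y = "traj f u x k"
  obtain v where v: "v \<in> U" "Vf (f ?y v) + l ?y v \<le> (1 + \<epsilon>f) * Vf ?y"
    using Vf_relaxed_CLF by blast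
  have "V (k + 1) x \<le> (\<Sum>j<k. l (traj f u x j) (u j)) + V 1 ?y"
    using assms(1) by (intro V_le_split) auto
  also have "V 1 ?y \<le> (1 + \<epsilon>f) * Vf ?y"
    using V_Suc_le[OF v(1), of 0 ?y] v(2) by (simp add: opt_cost_0)
  finally show ?thesis using assms(2) by (simp add: cost_def algebra_simps)
qed

text \<open>
  Lengthening the horizon by one step multiplies the optimal cost by at most \<open>1 + \<epsilon>f\<close>, so the
  increment is at most the fraction \<open>\<epsilon>f / (1 + \<epsilon>f)\<close> of the larger cost. Bounding the larger
  instead of the smaller cost by controllability gains the factor \<open>1 + \<epsilon>f\<close> in
  the denominator of \<open>\<alpha>\<close>.
\<close>

lemma V_Suc_increment: "(1 + \<epsilon>f) * (V (Suc k) x - V k x) \<le> \<epsilon>f * \<gamma>_up * \<sigma> x"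
proof -
  obtain u where u: "u \<in> inputs k U" "V k x = cost f l Vf k x u" by (rule V_minimizer)
  have "Vf (traj f u x k) \<le> V k x"
    unfolding u(2) cost_def using u(1) by (auto intro!: sum_nonneg l_nonneg)
  hence "V (Suc k) x \<le> V k x + \<epsilon>f * V k x"
    using V_Suc_le_terminal[OF u] \<epsilon>f_pos by (smt (verit) mult_left_mono)
  hence "(1 + \<epsilon>f) * (V (Suc k) x - V k x) \<le> \<epsilon>f * V (Suc k) x"
    by (simp add: algebra_simps)
  also have "\<dots> \<le> \<epsilon>f * (\<gamma>_up * \<sigma> x)"
    using V_upper \<epsilon>f_pos by (intro mult_left_mono) auto
  finally show ?thesis by (simp add: mult.assoc)
qed

text \<open>Detectability, summed along a trajectory, turns stage costs into a bound on \<open>\<sigma>\<close>.\<close>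

lemma sum_detectability:
  assumes "\<And>j. j < k \<Longrightarrow> u j \<in> U"
  shows "\<epsilon>o * (\<Sum>j<k. \<sigma> (traj f u x j)) + W (traj f u x k)
           \<le> (\<Sum>j<k. l (traj f u x j) (u j)) + W x"
  using assms
proof (induction k)
  case (Suc k)
  show ?case
    using Suc.IH W_decrease[OF Suc.prems[of k], of "traj f u x k"] Suc.prems
    by (simp add: algebra_simps)
qed simp

lemma Y_lower:
  assumes "N \<ge> 1"
  shows "\<epsilon>o * \<sigma> x \<le> Y N x"
proof -
  obtain u where u: "u \<in> inputs N U" "V N x = cost f l Vf N x u" by (rule V_minimizer)
  have inU: "u j \<in> U" if "j < N" for j using u(1) that by auto
  have "\<sigma> x = (\<Sum>j<1. \<sigma> (traj f u x j))" by simp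
  also have "\<dots> \<le> (\<Sum>j<N. \<sigma> (traj f u x j))"
    using assms by (intro sum_mono2 \<sigma>_nonneg) auto
  finally have "\<epsilon>o * \<sigma> x \<le> \<epsilon>o * (\<Sum>j<N. \<sigma> (traj f u x j))" using \<epsilon>o_pos by simp
  thus ?thesis
    using sum_detectability[of N u x] inU W_nonneg[of "traj f u x N"] Vf_nonneg[of "traj f u x N"]
    by (simp add: u(2) cost_def)
qed

lemma Y_upper: "N \<ge> 1 \<Longrightarrow> Y N x \<le> (\<gamma> N + \<gamma>o) * \<sigma> x"
  using V_bound[of N x] W_upper[of x] by (simp add: algebra_simps)

lemma Y_upper_uniform: "N \<ge> 1 \<Longrightarrow> Y N x \<le> (\<gamma>_up + \<gamma>o) * \<sigma> x"
  using V_upper[of "N - 1" x] W_upper[of x] by (simp add: algebra_simps)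

lemma \<alpha>_denominator_pos: "N \<ge> 1 \<Longrightarrow> 0 < (real N - 1) * \<epsilon>o * (1 + \<epsilon>f) + \<gamma>_up"
  using \<epsilon>o_pos \<epsilon>f_pos \<gamma>_up_pos by (intro add_nonneg_pos) auto

lemma \<alpha>_le_1: "N \<ge> 1 \<Longrightarrow> \<alpha> N \<le> 1"
  unfolding \<alpha>_def using \<alpha>_denominator_pos[of N] \<epsilon>o_pos \<epsilon>f_pos \<gamma>_up_pos \<gamma>o_nonneg \<gamma>_nonneg[of N]
  by simp

lemma \<alpha>_pos:
  assumes "N \<ge> 1"
    and "real N > 1 + \<epsilon>f / (1 + \<epsilon>f) * (\<gamma>_up * (\<gamma>_up + \<gamma>o) / \<epsilon>o\<^sup>2) - \<gamma>_up / (\<epsilon>o * (1 + \<epsilon>f))"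
  shows "0 < \<alpha> N"
proof -
  have pos: "\<epsilon>o\<^sup>2 * (1 + \<epsilon>f) > 0" using \<epsilon>o_pos \<epsilon>f_pos by simp
  have "\<epsilon>o\<^sup>2 * (1 + \<epsilon>f) * (\<epsilon>f / (1 + \<epsilon>f) * (\<gamma>_up * (\<gamma>_up + \<gamma>o) / \<epsilon>o\<^sup>2) - \<gamma>_up / (\<epsilon>o * (1 + \<epsilon>f)))
        = \<epsilon>f * \<gamma>_up * (\<gamma>_up + \<gamma>o) - \<epsilon>o * \<gamma>_up"
    using \<epsilon>o_pos \<epsilon>f_pos by (simp add: divide_simps power2_eq_square)
  moreover have "\<epsilon>o\<^sup>2 * (1 + \<epsilon>f) *
      (\<epsilon>f / (1 + \<epsilon>f) * (\<gamma>_up * (\<gamma>_up + \<gamma>o) / \<epsilon>o\<^sup>2) - \<gamma>_up / (\<epsilon>o * (1 + \<epsilon>f)))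
        < \<epsilon>o\<^sup>2 * (1 + \<epsilon>f) * (real N - 1)"
    using assms(2) pos by (intro mult_strict_left_mono) auto
  ultimately have "\<epsilon>f * \<gamma>_up * (\<gamma>_up + \<gamma>o) - \<epsilon>o * \<gamma>_up < \<epsilon>o\<^sup>2 * (1 + \<epsilon>f) * (real N - 1)"
    by simp
  moreover have "\<epsilon>f * \<gamma>_up * (\<gamma> N + \<gamma>o) \<le> \<epsilon>f * \<gamma>_up * (\<gamma>_up + \<gamma>o)"
    using \<gamma>_le[OF assms(1)] \<epsilon>f_pos \<gamma>_up_pos by (intro mult_left_mono) auto
  ultimately have "(\<gamma> N + \<gamma>o) * \<epsilon>f * \<gamma>_up < \<epsilon>o * ((real N - 1) * \<epsilon>o * (1 + \<epsilon>f) + \<gamma>_up)"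
    by (simp add: algebra_simps power2_eq_square)
  thus ?thesis
    unfolding \<alpha>_def using \<alpha>_denominator_pos[OF assms(1)] \<epsilon>o_pos by simp
qed

lemma \<alpha>_tendsto_1: "\<alpha> \<longlonglongrightarrow> 1"
proof (rule tendsto_sandwich)
  let ?d = "\<lambda>N. \<epsilon>o * ((real N - 1) * \<epsilon>o * (1 + \<epsilon>f) + \<gamma>_up)"
  let ?c = "(\<gamma>_up + \<gamma>o) * \<epsilon>f * \<gamma>_up"
  show "eventually (\<lambda>N. 1 - ?c / ?d N \<le> \<alpha> N) sequentially"
  proof (rule eventually_mono[OF eventually_ge_at_top[of 1]])
    fix N :: nat assume N: "N \<ge> 1"
    have "(\<gamma> N + \<gamma>o) * \<epsilon>f * \<gamma>_up \<le> ?c"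
      using \<gamma>_le[OF N] \<epsilon>f_pos \<gamma>_up_pos by (intro mult_right_mono) auto
    thus "1 - ?c / ?d N \<le> \<alpha> N"
      unfolding \<alpha>_def using \<alpha>_denominator_pos[OF N] \<epsilon>o_pos by (simp add: divide_right_mono)
  qed
  show "eventually (\<lambda>N. \<alpha> N \<le> 1) sequentially"
    by (rule eventually_mono[OF eventually_ge_at_top[of 1]]) (rule \<alpha>_le_1)
  have "filterlim (\<lambda>N. (\<epsilon>o * \<epsilon>o * (1 + \<epsilon>f)) * real N) at_top sequentially"
    using \<epsilon>o_pos \<epsilon>f_pos
    by (intro filterlim_tendsto_pos_mult_at_top[OF tendsto_const _ filterlim_real_sequentially]) auto
  hence "filterlim (\<lambda>N. \<epsilon>o * (\<gamma>_up - \<epsilon>o * (1 + \<epsilon>f)) + (\<epsilon>o * \<epsilon>o * (1 + \<epsilon>f)) * real N)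
           at_top sequentially"
    by (rule filterlim_tendsto_add_at_top[OF tendsto_const])
  hence "filterlim ?d at_top sequentially" by (simp add: algebra_simps)
  hence "(\<lambda>N. ?c / ?d N) \<longlonglongrightarrow> 0"
    by (intro tendsto_divide_0[OF tendsto_const] filterlim_at_top_imp_at_infinity)
  thus "(\<lambda>N. 1 - ?c / ?d N) \<longlonglongrightarrow> 1"
    using tendsto_diff[OF tendsto_const, of "\<lambda>N. ?c / ?d N" 0 sequentially 1] by simp
qed simp


section \<open>The closed loop\<close>

text \<open>
  The suboptimality \<open>E\<close> of the first step of a minimizer is bounded in \<open>N\<close> ways: by the
  increment of the terminal cost at the end of the minimizer, and, re-optimizing the tail from any
  of the states \<open>x\<^sub>1, \<dots>, x\<^sub>N\<^sub>-\<^sub>1\<close>, by a multiple of \<open>\<sigma>\<close> at that state. Since detectability bounds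
  the sum of all these quantities by \<open>Y N x\<close>, their minimum is of order \<open>1 / N\<close>.
\<close>

lemma first_step_suboptimality:
  assumes "N \<ge> 1" and u: "u \<in> inputs N U" "V N x = cost f l Vf N x u"
  shows "l x (u 0) + V N (f x (u 0)) - V N x \<le> (1 - \<alpha> N) * \<epsilon>o * \<sigma> x"
proof -
  define E where "E = l x (u 0) + V N (f x (u 0)) - V N x"
  define X where "X = traj f u x"
  have [simp]: "X 0 = x" by (simp add: X_def)
  have inU: "u j \<in> U" if "j < N" for j using u(1) that by auto
  have E_le: "E \<le> V (Suc (N - k)) (X k) - V (N - k) (X k)" if k_range: "1 \<le> k" "k \<le> N" for k
  proof -
    obtain i where k: "k = Suc i" using k_range(1) Suc_le_D by auto
    let ?v = "\<lambda>j. u (Suc j)"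
    have v: "traj f ?v (f x (u 0)) j = X (Suc j)" for j
      by (simp add: X_def traj_Suc_shift del: traj.simps)
    have "V (i + Suc (N - k)) (f x (u 0))
        \<le> (\<Sum>j<i. l (X (Suc j)) (u (Suc j))) + V (Suc (N - k)) (X k)"
      using V_le_split[of i ?v "Suc (N - k)" "f x (u 0)"] inU k_range(2) by (simp add: v k)
    moreover have "V N x = (\<Sum>j<k. l (X j) (u j)) + V (N - k) (X k)"
      using V_eq_split[of u k "N - k" x] u k_range(2) by (simp add: X_def)
    moreover have "i + Suc (N - k) = N" using k k_range(2) by simp
    ultimately show ?thesis
      by (simp add: E_def k sum.lessThan_Suc_shift del: sum.lessThan_Suc)
  qed
  have E_terminal: "E \<le> \<epsilon>f * Vf (X N)"
  proof -
    have "V 1 (X N) \<le> V 0 (X N) + \<epsilon>f * Vf (X N)"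
      using V_Suc_le_terminal[of "\<lambda>_. undefined" 0 "X N"] by (simp add: opt_cost_0 cost_def)
    thus ?thesis using E_le[of N] assms(1) by simp
  qed
  have E_stage: "(1 + \<epsilon>f) * E \<le> \<epsilon>f * \<gamma>_up * \<sigma> (X k)" if "1 \<le> k" "k < N" for k
  proof -
    have "(1 + \<epsilon>f) * E \<le> (1 + \<epsilon>f) * (V (Suc (N - k)) (X k) - V (N - k) (X k))"
      using E_le[of k] that \<epsilon>f_pos by (intro mult_left_mono) auto
    also note V_Suc_increment
    finally show ?thesis .
  qed
  have split: "(\<Sum>k<N. \<sigma> (X k)) = \<sigma> x + (\<Sum>k\<in>{1..<N}. \<sigma> (X k))"
  proof -
    have "{..<N} = insert 0 {1..<N}" using assms(1) by auto
    thus ?thesis by simp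
  qed
  have "(real N - 1) * ((1 + \<epsilon>f) * E) = (\<Sum>k\<in>{1..<N}. (1 + \<epsilon>f) * E)"
    using assms(1) by (simp add: of_nat_diff)
  also have "\<dots> \<le> (\<Sum>k\<in>{1..<N}. \<epsilon>f * \<gamma>_up * \<sigma> (X k))"
    using E_stage by (intro sum_mono) auto
  also have "\<dots> \<le> \<epsilon>f * \<gamma>_up * (\<Sum>k<N. \<sigma> (X k))"
    unfolding split using \<epsilon>f_pos \<gamma>_up_pos \<sigma>_nonneg[of x]
    by (simp add: sum_distrib_left[symmetric])
  finally have "\<epsilon>o * ((real N - 1) * ((1 + \<epsilon>f) * E)) \<le> \<epsilon>o * (\<epsilon>f * \<gamma>_up * (\<Sum>k<N. \<sigma> (X k)))"
    using \<epsilon>o_pos by simp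
  moreover have "\<gamma>_up * E \<le> \<gamma>_up * (\<epsilon>f * Vf (X N))"
    using E_terminal \<gamma>_up_pos by simp
  ultimately have "((real N - 1) * \<epsilon>o * (1 + \<epsilon>f) + \<gamma>_up) * E
      \<le> \<epsilon>f * \<gamma>_up * (\<epsilon>o * (\<Sum>k<N. \<sigma> (X k)) + Vf (X N))"
    by (simp add: algebra_simps)
  also have "\<epsilon>o * (\<Sum>k<N. \<sigma> (X k)) + Vf (X N) \<le> Y N x"
    using sum_detectability[of N u x] inU W_nonneg[of "X N"] u(2) by (simp add: cost_def X_def)
  hence "\<epsilon>f * \<gamma>_up * (\<epsilon>o * (\<Sum>k<N. \<sigma> (X k)) + Vf (X N)) \<le> \<epsilon>f * \<gamma>_up * ((\<gamma> N + \<gamma>o) * \<sigma> x)"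
    using Y_upper[OF assms(1), of x] \<epsilon>f_pos \<gamma>_up_pos by (intro mult_left_mono) auto
  finally have "E \<le> \<epsilon>f * \<gamma>_up * ((\<gamma> N + \<gamma>o) * \<sigma> x) / ((real N - 1) * \<epsilon>o * (1 + \<epsilon>f) + \<gamma>_up)"
    using \<alpha>_denominator_pos[OF assms(1)] by (simp add: pos_le_divide_eq mult.commute)
  also have "\<dots> = (1 - \<alpha> N) * \<epsilon>o * \<sigma> x"
    unfolding \<alpha>_def using \<alpha>_denominator_pos[OF assms(1)] \<epsilon>o_pos
    by (simp add: divide_simps)
  finally show ?thesis by (simp add: E_def)
qed

context
  fixes N :: nat and ustar :: "'x \<Rightarrow> nat \<Rightarrow> 'u" and \<mu> :: "'x \<Rightarrow> 'u"
  assumes N: "N \<ge> 1" and ustar: "optimal_selection f U l Vf N ustar"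
    and \<mu>: "\<mu> \<equiv> \<lambda>x. ustar x 0"
begin

lemma ustar_minimizer: "ustar x \<in> inputs N U" "V N x = cost f l Vf N x (ustar x)"
proof -
  have min: "is_arg_min (cost f l Vf N x) (\<lambda>u. u \<in> inputs N U) (ustar x)"
    using ustar by (simp add: optimal_selection_def)
  thus "ustar x \<in> inputs N U" by (simp add: is_arg_min_linorder)
  show "V N x = cost f l Vf N x (ustar x)" by (rule opt_cost_eq_minimum[OF min])
qed

lemma feedback_in_U: "\<mu> x \<in> U"
  unfolding \<mu> using PiE_mem[OF ustar_minimizer(1)] N by simp

lemma Y_decrease: "Y N (f x (\<mu> x)) - Y N x \<le> - \<epsilon>o * \<alpha> N * \<sigma> x"
  using first_step_suboptimality[OF N ustar_minimizer, of x] W_decrease[OF feedback_in_U, of x x]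
  by (simp add: \<mu> algebra_simps)

text \<open>
  The stage cost, rotated by the storage function \<open>W\<close>, dominates \<open>\<epsilon>o * \<sigma>\<close>. Hence the
  suboptimality is at most the fraction \<open>1 - \<alpha> N\<close> of the rotated stage cost.
\<close>

lemma Y_decrease_rotated:
  "Y N (f x (\<mu> x)) - Y N x \<le> - \<alpha> N * (l x (\<mu> x) + W x - W (f x (\<mu> x)))"
proof -
  have "\<epsilon>o * \<sigma> x \<le> l x (\<mu> x) + W x - W (f x (\<mu> x))"
    using W_decrease[OF feedback_in_U, of x x] by simp
  hence "(1 - \<alpha> N) * (\<epsilon>o * \<sigma> x) \<le> (1 - \<alpha> N) * (l x (\<mu> x) + W x - W (f x (\<mu> x)))"
    using \<alpha>_le_1[OF N] by (intro mult_left_mono) auto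
  thus ?thesis
    using first_step_suboptimality[OF N ustar_minimizer, of x] by (simp add: \<mu> algebra_simps)
qed

lemma closed_loop_partial_cost:
  "\<alpha> N * ((\<Sum>k<K. l (closed_loop f \<mu> x k) (\<mu> (closed_loop f \<mu> x k))) + W x) \<le> Y N x"
proof -
  let ?X = "closed_loop f \<mu> x"
  have "\<alpha> N * ((\<Sum>k<K. l (?X k) (\<mu> (?X k))) + W x - W (?X K)) \<le> Y N x - Y N (?X K)"
  proof (induction K)
    case (Suc K)
    show ?case using Suc.IH Y_decrease_rotated[of "?X K"] by (simp add: algebra_simps)
  qed simp
  moreover have "\<alpha> N * W (?X K) \<le> W (?X K)"
    using mult_right_mono[OF \<alpha>_le_1[OF N] W_nonneg] by simp
  ultimately show ?thesis using V_nonneg[of N "?X K"] by (simp add: algebra_simps)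
qed

lemma closed_loop_cost_le:
  assumes "\<alpha> N > 0"
  shows "closed_loop_cost f l \<mu> x \<le> ereal (Y N x / \<alpha> N - W x)"
  unfolding closed_loop_cost_def
proof (rule suminf_bound, rule allI)
  fix K
  show "(\<Sum>k<K. ereal (l (closed_loop f \<mu> x k) (\<mu> (closed_loop f \<mu> x k))))
      \<le> ereal (Y N x / \<alpha> N - W x)"
    using closed_loop_partial_cost[where x = x and K = K] assms
    by (simp add: le_diff_eq pos_le_divide_eq mult.commute)
qed (simp add: l_nonneg feedback_in_U)

lemma opt_cost_inf_le_closed_loop_cost:
  "opt_cost_inf f U l x \<le> closed_loop_cost f l \<mu> x"
proof -
  have "(\<lambda>j. \<mu> (closed_loop f \<mu> x j)) \<in> UNIV \<rightarrow> U" using feedback_in_U by auto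
  thus ?thesis
    unfolding opt_cost_inf_def closed_loop_cost_def
    by (intro INF_lower2[where i = "\<lambda>j. \<mu> (closed_loop f \<mu> x j)"])
       (auto simp: closed_loop_eq_traj[symmetric])
qed

lemma sum_\<sigma>_closed_loop_le:
  "\<epsilon>o * \<alpha> N * (\<Sum>k<K. \<sigma> (closed_loop f \<mu> x k)) + Y N (closed_loop f \<mu> x K) \<le> Y N x"
proof (induction K)
  case (Suc K)
  show ?case using Suc.IH Y_decrease[of "closed_loop f \<mu> x K"] by (simp add: algebra_simps)
qed simp

lemma \<sigma>_closed_loop_le:
  assumes "\<alpha> N > 0"
  shows "\<sigma> (closed_loop f \<mu> x k) \<le> (\<gamma>_up + \<gamma>o) / \<epsilon>o * \<sigma> x"
proof -
  have "0 \<le> \<epsilon>o * \<alpha> N * (\<Sum>j<k. \<sigma> (closed_loop f \<mu> x j))"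
    using \<epsilon>o_pos assms by (intro mult_nonneg_nonneg sum_nonneg \<sigma>_nonneg) auto
  hence "\<epsilon>o * \<sigma> (closed_loop f \<mu> x k) \<le> (\<gamma>_up + \<gamma>o) * \<sigma> x"
    using sum_\<sigma>_closed_loop_le[where x = x and K = k] Y_lower[OF N, of "closed_loop f \<mu> x k"]
      Y_upper_uniform[OF N, of x] by linarith
  thus ?thesis using \<epsilon>o_pos by (simp add: field_simps)
qed

lemma \<sigma>_closed_loop_tendsto_0:
  assumes "\<alpha> N > 0"
  shows "(\<lambda>k. \<sigma> (closed_loop f \<mu> x k)) \<longlonglongrightarrow> 0"
proof (rule summable_LIMSEQ_zero, rule bounded_imp_summable)
  fix K
  have pos: "\<epsilon>o * \<alpha> N > 0" using \<epsilon>o_pos assms by simp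
  have "\<epsilon>o * \<alpha> N * (\<Sum>k<Suc K. \<sigma> (closed_loop f \<mu> x k)) \<le> Y N x"
    using sum_\<sigma>_closed_loop_le[where x = x and K = "Suc K"]
      V_nonneg[of N "closed_loop f \<mu> x (Suc K)"] W_nonneg[of "closed_loop f \<mu> x (Suc K)"]
    by linarith
  thus "(\<Sum>k\<le>K. \<sigma> (closed_loop f \<mu> x k)) \<le> Y N x / (\<epsilon>o * \<alpha> N)"
    using pos by (simp add: pos_le_divide_eq lessThan_Suc_atMost mult.commute del: sum.lessThan_Suc)
qed (rule \<sigma>_nonneg)

end


section \<open>The infinite-horizon cost\<close>

text \<open>
  A uniform bound on all finite-horizon costs does not bound \<open>V\<^sub>\<infinity>\<close> by itself, because the
  minimizers of different horizons are unrelated. But the closed loop with horizon \<open>M\<close> provides an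
  infinite input whose cost plus \<open>W\<close> is at most \<open>Y M x / \<alpha> M\<close>, and \<open>\<alpha> M\<close> tends to \<open>1\<close>.
\<close>

lemma opt_cost_inf_le: "opt_cost_inf f U l x \<le> ereal ((\<gamma>_up + \<gamma>o) * \<sigma> x - W x)"
proof (rule tendsto_lowerbound)
  have "(\<lambda>M. (\<gamma>_up + \<gamma>o) * \<sigma> x / \<alpha> M - W x) \<longlonglongrightarrow> (\<gamma>_up + \<gamma>o) * \<sigma> x / 1 - W x"
    by (intro tendsto_intros \<alpha>_tendsto_1) simp
  thus "((\<lambda>M. ereal ((\<gamma>_up + \<gamma>o) * \<sigma> x / \<alpha> M - W x))
      \<longlongrightarrow> ereal ((\<gamma>_up + \<gamma>o) * \<sigma> x - W x)) sequentially"
    by simp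
  have "eventually (\<lambda>M. \<alpha> M > 0) sequentially"
    using order_tendstoD(1)[OF \<alpha>_tendsto_1, of 0] by simp
  thus "eventually (\<lambda>M. opt_cost_inf f U l x \<le> ereal ((\<gamma>_up + \<gamma>o) * \<sigma> x / \<alpha> M - W x)) sequentially"
    using eventually_ge_at_top[of 1]
  proof eventually_elim
    case (elim M)
    obtain v where v: "optimal_selection f U l Vf M v"
      unfolding optimal_selection_def using minimizers_exist[OF elim(2)] by metis
    have "opt_cost_inf f U l x \<le> closed_loop_cost f l (\<lambda>x. v x 0) x"
      by (rule opt_cost_inf_le_closed_loop_cost[OF elim(2) v])
    also have "\<dots> \<le> ereal (Y M x / \<alpha> M - W x)"
      by (rule closed_loop_cost_le[OF elim(2) v _ elim(1)])
    also have "\<dots> \<le> ereal ((\<gamma>_up + \<gamma>o) * \<sigma> x / \<alpha> M - W x)"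
      using Y_upper_uniform[OF elim(2), of x] elim(1) by (simp add: divide_right_mono)
    finally show ?case .
  qed
qed simp

lemma opt_cost_inf_nonneg: "0 \<le> opt_cost_inf f U l x"
  unfolding opt_cost_inf_def
  by (intro INF_greatest suminf_0_le) (auto simp: l_nonneg Pi_iff)

definition V_inf :: "'x \<Rightarrow> real" where
  "V_inf x = real_of_ereal (opt_cost_inf f U l x)"

lemma opt_cost_inf_eq: "opt_cost_inf f U l x = ereal (V_inf x)"
  unfolding V_inf_def using opt_cost_inf_le[of x] opt_cost_inf_nonneg[of x]
  by (cases "opt_cost_inf f U l x") auto

lemma V_inf_nonneg: "0 \<le> V_inf x"
  using opt_cost_inf_nonneg[of x] by (simp add: opt_cost_inf_eq)

lemma V_inf_upper: "V_inf x + W x \<le> (\<gamma>_up + \<gamma>o) * \<sigma> x"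
  using opt_cost_inf_le[of x] by (simp add: opt_cost_inf_eq)

lemma V_inf_near_minimizer:
  assumes "e > 0"
  shows "\<exists>u. (\<forall>j. u j \<in> U) \<and> (\<forall>k. (\<Sum>j<k. l (traj f u x j) (u j)) \<le> V_inf x + e)"
proof -
  have "opt_cost_inf f U l x < ereal (V_inf x + e)"
    using assms by (simp add: opt_cost_inf_eq)
  then obtain u where u: "u \<in> UNIV \<rightarrow> U"
    "(\<Sum>k. ereal (l (traj f u x k) (u k))) < ereal (V_inf x + e)"
    unfolding opt_cost_inf_def INF_less_iff by blast
  have inU: "u j \<in> U" for j using u(1) by auto
  have "(\<Sum>j<k. l (traj f u x j) (u j)) \<le> V_inf x + e" for k
  proof -
    have "ereal (\<Sum>j<k. l (traj f u x j) (u j)) = (\<Sum>j<k. ereal (l (traj f u x j) (u j)))"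
      by simp
    also have "\<dots> \<le> (\<Sum>j. ereal (l (traj f u x j) (u j)))"
      using inU by (intro suminf_upper) (auto simp: l_nonneg)
    also note u(2)
    finally show ?thesis by simp
  qed
  thus ?thesis using inU by blast
qed

lemma V_inf_le_Suc:
  assumes "u \<in> U"
  shows "V_inf x \<le> l x u + V_inf (f x u)"
proof (rule field_le_epsilon)
  fix e :: real assume "e > 0"
  obtain v where v: "\<And>j. v j \<in> U"
    "\<And>k. (\<Sum>j<k. l (traj f v (f x u) j) (v j)) \<le> V_inf (f x u) + e"
    using V_inf_near_minimizer[OF \<open>e > 0\<close>, of "f x u"] by blast
  define w where "w = case_nat u v"
  have w_in: "w j \<in> U" for j using assms v(1) by (simp add: w_def split: nat.split)
  have w_shift: "w 0 = u" "(\<lambda>j. w (Suc j)) = v" by (simp_all add: w_def)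
  have "w \<in> UNIV \<rightarrow> U" using w_in by simp
  hence "opt_cost_inf f U l x \<le> (\<Sum>k. ereal (l (traj f w x k) (w k)))"
    unfolding opt_cost_inf_def by (rule INF_lower)
  also have "\<dots> \<le> ereal (l x u + V_inf (f x u) + e)"
  proof (rule suminf_bound, rule allI)
    fix K
    show "(\<Sum>k<K. ereal (l (traj f w x k) (w k))) \<le> ereal (l x u + V_inf (f x u) + e)"
    proof (cases K)
      case 0
      thus ?thesis using l_nonneg[OF assms, of x] V_inf_nonneg[of "f x u"] \<open>e > 0\<close> by simp
    next
      case (Suc i)
      have "traj f w x (Suc j) = traj f v (f x u) j" for j
        unfolding traj_Suc_shift w_shift ..
      moreover have "w (Suc j) = v j" for j by (simp add: w_def)
      ultimately have "(\<Sum>k<K. l (traj f w x k) (w k))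
          = l x u + (\<Sum>j<i. l (traj f v (f x u) j) (v j))"
        unfolding Suc sum.lessThan_Suc_shift by (simp only: traj.simps(1) w_shift(1))
      thus ?thesis using v(2)[of i] by simp
    qed
  qed (simp add: l_nonneg w_in)
  finally show "V_inf x \<le> l x u + V_inf (f x u) + e" by (simp add: opt_cost_inf_eq)
qed

lemma V_inf_le_split:
  assumes "\<And>j. u j \<in> U"
  shows "V_inf x \<le> (\<Sum>j<k. l (traj f u x j) (u j)) + V_inf (traj f u x k)"
proof (induction k)
  case (Suc k)
  show ?case using Suc.IH V_inf_le_Suc[OF assms[of k], of "traj f u x k"] by simp
qed simp

text \<open>
  Along an infinite input that is optimal up to \<open>e\<close>, the remaining budget \<open>Z\<close> plays the role of
  \<open>V\<^sub>\<infinity> + W\<close>: it drops by \<open>\<epsilon>o * \<sigma>\<close> in each step and exceeds \<open>(\<gamma>_up + \<gamma>o) * \<sigma>\<close> by at most \<open>e\<close>.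
  So \<open>Z - e\<close> contracts geometrically, and truncating the input after \<open>N\<close> steps costs at
  most the terminal cost of a state with small \<open>\<sigma>\<close>.
\<close>

lemma Y_le_Y_inf:
  assumes "N \<ge> 1" "cf \<ge> 0" and Vf_upper: "\<And>x. Vf x \<le> cf * \<sigma> x"
  shows "Y N x \<le> (1 + cf / \<epsilon>o * (1 - \<epsilon>o / (\<gamma>_up + \<gamma>o)) ^ N) * (V_inf x + W x)"
proof (cases "\<sigma> x = 0")
  \<comment> \<open>If \<open>\<sigma>\<close> vanishes identically, the contraction factor may be negative. Where \<open>\<sigma>\<close> vanishes,
    both sides are \<open>0\<close>; a state where it does not vanish forces \<open>\<epsilon>o \<le> \<gamma>_up + \<gamma>o\<close>.\<close>
  case True
  have "V_inf x + W x = 0"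
    using V_inf_upper[of x] V_inf_nonneg[of x] W_nonneg[of x] True by simp
  thus ?thesis using Y_upper_uniform[OF assms(1), of x] True by simp
next
  case False
  let ?C = "\<gamma>_up + \<gamma>o"
  define \<rho> where "\<rho> = 1 - \<epsilon>o / ?C"
  have C: "?C > 0" using \<gamma>_up_pos \<gamma>o_nonneg by simp
  have "\<epsilon>o * \<sigma> x \<le> ?C * \<sigma> x"
    using Y_lower[OF assms(1), of x] Y_upper_uniform[OF assms(1), of x] by simp
  hence "\<epsilon>o \<le> ?C" using False \<sigma>_nonneg[of x] by simp
  hence \<rho>: "0 \<le> \<rho>" using C by (simp add: \<rho>_def)
  have approx: "Y N x \<le> V_inf x + W x + e + cf / \<epsilon>o * (\<rho> ^ N * (V_inf x + W x) + e)"
    if "e > 0" for e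
  proof -
    obtain u where u: "\<And>j. u j \<in> U" "\<And>k. (\<Sum>j<k. l (traj f u x j) (u j)) \<le> V_inf x + e"
      using V_inf_near_minimizer[OF \<open>e > 0\<close>, of x] by blast
    define X where "X = traj f u x"
    define S where "S k = (\<Sum>j<k. l (X j) (u j))" for k
    define Z where "Z k = V_inf x + e - S k + W (X k)" for k
    have S_le: "S k \<le> V_inf x + e" for k using u(2) by (simp add: S_def X_def)
    have Z_step: "Z (Suc k) \<le> Z k - \<epsilon>o * \<sigma> (X k)" for k
      using W_decrease[OF u(1)[of k], of "X k"] by (simp add: Z_def S_def X_def)
    have Z_upper: "Z k - e \<le> ?C * \<sigma> (X k)" for k
      using V_inf_le_split[where u = u and x = x and k = k] u(1) V_inf_upper[of "X k"]
      by (simp add: Z_def S_def X_def)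
    have Z_contract: "Z k - e \<le> \<rho> ^ k * (V_inf x + W x)" for k
    proof (induction k)
      case (Suc k)
      have "(Z k - e) * (\<epsilon>o / ?C) \<le> ?C * \<sigma> (X k) * (\<epsilon>o / ?C)"
        using Z_upper[of k] \<epsilon>o_pos C by (intro mult_right_mono) auto
      also have "\<dots> = \<epsilon>o * \<sigma> (X k)" using C by simp
      finally have "Z (Suc k) - e \<le> (Z k - e) - (Z k - e) * (\<epsilon>o / ?C)"
        using Z_step[of k] by linarith
      also have "\<dots> = \<rho> * (Z k - e)" by (simp add: \<rho>_def algebra_simps)
      also have "\<dots> \<le> \<rho> * (\<rho> ^ k * (V_inf x + W x))" using Suc \<rho> by (rule mult_left_mono)
      finally show ?case by (simp add: mult.assoc)
    qed (simp add: Z_def S_def X_def)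
    have "\<epsilon>o * \<sigma> (X N) \<le> Z N"
      using Z_step[of N] S_le[of "Suc N"] W_nonneg[of "X (Suc N)"] by (simp add: Z_def)
    hence "\<sigma> (X N) \<le> (\<rho> ^ N * (V_inf x + W x) + e) / \<epsilon>o"
      using Z_contract[of N] \<epsilon>o_pos by (simp add: pos_le_divide_eq mult.commute)
    hence "cf * \<sigma> (X N) \<le> cf * ((\<rho> ^ N * (V_inf x + W x) + e) / \<epsilon>o)"
      using assms(2) by (rule mult_left_mono)
    moreover have "V N x \<le> S N + Vf (X N)"
      using V_le_cost[of N u x] u(1) by (simp add: cost_def S_def X_def)
    ultimately show ?thesis
      using S_le[of N] Vf_upper[of "X N"] by simp
  qed
  have "((\<lambda>e. V_inf x + W x + e + cf / \<epsilon>o * (\<rho> ^ N * (V_inf x + W x) + e)) \<longlongrightarrow>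
          V_inf x + W x + 0 + cf / \<epsilon>o * (\<rho> ^ N * (V_inf x + W x) + 0)) (at_right 0)"
    by (intro tendsto_intros)
  moreover have "eventually (\<lambda>e. Y N x \<le>
      V_inf x + W x + e + cf / \<epsilon>o * (\<rho> ^ N * (V_inf x + W x) + e)) (at_right 0)"
    using approx by (auto simp: eventually_at_filter)
  ultimately have "Y N x \<le> V_inf x + W x + 0 + cf / \<epsilon>o * (\<rho> ^ N * (V_inf x + W x) + 0)"
    by (rule tendsto_lowerbound) simp
  thus ?thesis by (simp only: \<rho>_def add_0_right distrib_right mult_1_left mult.assoc)
qed

end


section \<open>Stability and performance\<close>

theorem theorem5:
  fixes f :: "real ^ 'n \<Rightarrow> real ^ 'm \<Rightarrow> real ^ 'n"
    and U :: "(real ^ 'm) set"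
    and l :: "real ^ 'n \<Rightarrow> real ^ 'm \<Rightarrow> real"
    and Vf \<sigma> W :: "real ^ 'n \<Rightarrow> real"
    and A :: "(real ^ 'n) set"
    and N :: nat
    and ustar :: "real ^ 'n \<Rightarrow> nat \<Rightarrow> real ^ 'm"
    and \<alpha>1 \<alpha>2 :: "real \<Rightarrow> real"
    and \<epsilon>o \<gamma>o_lo \<gamma>o_up \<gamma>f_up cf_lo cf_up \<epsilon>f :: real
    and \<gamma>f :: "nat \<Rightarrow> real"
  defines "V \<equiv> opt_cost f U l Vf"
    and "\<mu> \<equiv> (\<lambda>x. ustar x 0)"
    and "Y \<equiv> (\<lambda>x. opt_cost f U l Vf N x + W x)"
    and "Y_inf \<equiv> (\<lambda>x. opt_cost_inf f U l x + ereal (W x))"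
    and "\<alpha>N \<equiv> 1 - (\<gamma>f N + \<gamma>o_up) * \<epsilon>f * \<gamma>f_up
                    / (\<epsilon>o * ((real N - 1) * \<epsilon>o * (1 + \<epsilon>f) + \<gamma>f_up))"
    and "N_lo \<equiv> 1 + \<epsilon>f / (1 + \<epsilon>f) * (\<gamma>f_up * (\<gamma>f_up + \<gamma>o_up) / \<epsilon>o\<^sup>2)
                   - \<gamma>f_up / (\<epsilon>o * (1 + \<epsilon>f))"
  assumes horizon: "N \<ge> 1"
    and l_nonneg: "\<And>x u. u \<in> U \<Longrightarrow> 0 \<le> l x u"
    and Vf_nonneg: "\<And>x. 0 \<le> Vf x"
    and \<sigma>_nonneg: "\<And>x. 0 \<le> \<sigma> x"
    and minimizers_exist: "\<And>k x. k \<ge> 1 \<Longrightarrow> \<exists>u. is_arg_min (cost f l Vf k x) (\<lambda>u. u \<in> inputs k U) u"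
    and ustar: "optimal_selection f U l Vf N ustar"
    \<comment> \<open>state measure\<close>
    and \<alpha>_K_inf: "class_K_inf \<alpha>1" "class_K_inf \<alpha>2"
    and \<sigma>_bounds: "\<And>x. \<alpha>1 (infdist x A) \<le> \<sigma> x" "\<And>x. \<sigma> x \<le> \<alpha>2 (infdist x A)"
    \<comment> \<open>cost detectability\<close>
    and W_nonneg: "\<And>x. 0 \<le> W x"
    and detect_consts: "\<epsilon>o > 0" "\<gamma>o_lo \<ge> 0" "\<gamma>o_up \<ge> 0"
    and W_bounds: "\<And>x. \<gamma>o_lo * \<sigma> x \<le> W x" "\<And>x. W x \<le> \<gamma>o_up * \<sigma> x"
    and W_decrease: "\<And>x u. u \<in> U \<Longrightarrow> W (f x u) - W x \<le> - \<epsilon>o * \<sigma> x + l x u"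
    \<comment> \<open>cost controllability\<close>
    and control_consts: "\<gamma>f_up \<ge> 0" "\<And>k. k \<ge> 1 \<Longrightarrow> 0 \<le> \<gamma>f k" "\<And>k. k \<ge> 1 \<Longrightarrow> \<gamma>f k \<le> \<gamma>f_up"
    and V_bound: "\<And>k x. k \<ge> 1 \<Longrightarrow> V k x \<le> \<gamma>f k * \<sigma> x"
    \<comment> \<open>terminal cost\<close>
    and terminal_consts: "cf_lo > 0" "cf_up > 0" "\<epsilon>f > 0"
    and Vf_bounds: "\<And>x. cf_lo * \<sigma> x \<le> Vf x" "\<And>x. Vf x \<le> cf_up * \<sigma> x"
    and Vf_CLF: "\<And>x. \<exists>u. is_arg_min (\<lambda>u. Vf (f x u) + l x u) (\<lambda>u. u \<in> U) u
                          \<and> Vf (f x u) + l x u \<le> (1 + \<epsilon>f) * Vf x"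
    and cf_bounds: "cf_lo \<le> \<gamma>f 1 / (1 + \<epsilon>f)" "\<gamma>f 1 / (1 + \<epsilon>f) \<le> cf_up"
  shows "(\<forall>x. \<epsilon>o * \<sigma> x \<le> Y x \<and> Y x \<le> (\<gamma>f N + \<gamma>o_up) * \<sigma> x
            \<and> Y (f x (\<mu> x)) - Y x \<le> - \<epsilon>o * \<alpha>N * \<sigma> x)
       \<and> (real N > N_lo \<longrightarrow>
            0 < \<alpha>N \<and> \<alpha>N \<le> 1
          \<and> asymptotically_stable A (closed_loop f \<mu>)
          \<and> (\<forall>x0. ereal \<alpha>N * (closed_loop_cost f l \<mu> x0 + ereal (W x0))
                   \<le> ereal (1 + cf_up / \<epsilon>o * (1 - \<epsilon>o / (\<gamma>f_up + \<gamma>o_up)) ^ N) * Y_inf x0))"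
proof -
  have "0 < cf_lo * (1 + \<epsilon>f)" using terminal_consts by simp
  also have "\<dots> \<le> \<gamma>f 1" using cf_bounds(1) terminal_consts by (simp add: pos_le_divide_eq)
  also have "\<dots> \<le> \<gamma>f_up" using control_consts(3) by simp
  finally have \<gamma>f_up_pos: "\<gamma>f_up > 0" .
  have CLF: "\<exists>u\<in>U. Vf (f x u) + l x u \<le> (1 + \<epsilon>f) * Vf x" for x
    using Vf_CLF[of x] by (auto simp: is_arg_min_linorder)
  interpret ctrl: mpc f U l Vf \<sigma> W \<gamma>f \<epsilon>o \<gamma>o_up \<gamma>f_up \<epsilon>f
    using l_nonneg Vf_nonneg \<sigma>_nonneg W_nonneg minimizers_exist detect_consts(1,3) terminal_consts(3)
      \<gamma>f_up_pos W_bounds(2) W_decrease control_consts(2,3) V_bound[unfolded V_def] CLF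
    by (rule mpc.intro)
  have \<alpha>N: "\<alpha>N = ctrl.\<alpha> N" unfolding \<alpha>N_def ctrl.\<alpha>_def ..
  have Y: "Y x = opt_cost f U l Vf N x + W x" for x by (simp add: Y_def)
  note closed = horizon ustar \<mu>_def
  have "asymptotically_stable A (closed_loop f \<mu>)" if "\<alpha>N > 0"
  proof (rule asymptotically_stable_if_state_measure[OF \<alpha>_K_inf \<sigma>_bounds])
    show "0 < (\<gamma>f_up + \<gamma>o_up) / \<epsilon>o" using \<gamma>f_up_pos detect_consts by simp
  qed (use ctrl.\<sigma>_closed_loop_le[OF closed] ctrl.\<sigma>_closed_loop_tendsto_0[OF closed] that \<alpha>N in auto)
  moreover have "ereal \<alpha>N * (closed_loop_cost f l \<mu> x0 + ereal (W x0))
      \<le> ereal (1 + cf_up / \<epsilon>o * (1 - \<epsilon>o / (\<gamma>f_up + \<gamma>o_up)) ^ N) * Y_inf x0"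
    if "\<alpha>N > 0" for x0
  proof -
    have "closed_loop_cost f l \<mu> x0 \<le> ereal (Y x0 / \<alpha>N - W x0)"
      using ctrl.closed_loop_cost_le[OF closed] that by (simp add: \<alpha>N Y)
    hence "ereal \<alpha>N * (closed_loop_cost f l \<mu> x0 + ereal (W x0))
        \<le> ereal \<alpha>N * (ereal (Y x0 / \<alpha>N - W x0) + ereal (W x0))"
      using that by (intro ereal_mult_left_mono add_right_mono) auto
    also have "\<dots> = ereal (Y x0)" using that by simp
    also have "\<dots> \<le> ereal ((1 + cf_up / \<epsilon>o * (1 - \<epsilon>o / (\<gamma>f_up + \<gamma>o_up)) ^ N)
        * (ctrl.V_inf x0 + W x0))"
      using ctrl.Y_le_Y_inf[OF horizon _ Vf_bounds(2), of x0] terminal_consts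
      unfolding Y ereal_less_eq by simp
    finally show ?thesis by (simp add: Y_inf_def ctrl.opt_cost_inf_eq)
  qed
  moreover have "\<epsilon>o * \<sigma> x \<le> Y x \<and> Y x \<le> (\<gamma>f N + \<gamma>o_up) * \<sigma> x
      \<and> Y (f x (\<mu> x)) - Y x \<le> - \<epsilon>o * \<alpha>N * \<sigma> x" for x
    unfolding Y \<alpha>N
    using ctrl.Y_lower[OF horizon] ctrl.Y_upper[OF horizon] ctrl.Y_decrease[OF closed] by blast
  moreover have "\<alpha>N \<le> 1" unfolding \<alpha>N by (rule ctrl.\<alpha>_le_1[OF horizon])
  moreover have "0 < \<alpha>N" if "real N > N_lo"
    unfolding \<alpha>N using ctrl.\<alpha>_pos[OF horizon] that unfolding N_lo_def .
  ultimately show ?thesis by blast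
qed

end
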